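(* Let $X$ be a linear Hilbert algebra of finite size $n$, and let $I$ be an ideal of $X$. Then: (1) There exists $\rho$ such that $X/I$ operates on $I$ via $\rho$ as Hilbert algebras, and $X\cong I\bowtie_\rho(X/I)$. (2) Conversely, if $Y$ is a Hilbert algebra and there exists $\rho$ such that $Y$ operates on $I$ via $\rho$ as Hilbert algebras and $X\cong I\bowtie_\rho Y$, then $Y\cong X/I$.
   Context: An L-algebra is a set $X$ with a binary operation $\cdot$ and a distinguished element $1$ such that for all $x,y,z\in X$: $1\cdot x=x$ and $x\cdot 1=x\cdot x=1$; $(x\cdot y)\cdot(x\cdot z)=(y\cdot x)\cdot(y\cdot z)$; and $x\cdot y=y\cdot x=1$ implies $x=y$. It is partially ordered by $x\le y\iff x\cdot y=1$; it is linear if this order is total. A Hilbert algebra is an L-algebra with $x\cdot(y\cdot z)=(x\cdot y)\cdot(x\cdot z)$ for all $x,y,z$. $\mathrm{End}(X)$ is the set of maps $f:X\to X$ with $f(x\cdot y)=f(x)\cdot f(y)$. An ideal of $X$ is a nonempty subset $I\subseteq X$ such that for all $x\in I$, $y\in X$: (I1) $x\cdot y\in I$ implies $y\in I$; (I2) $y\cdot x\in I$; (I3) $(x\cdot y)\cdot y\in I$; (I4) $y\cdot(x\cdot y)\in I$. Ideals are closed under $\cdot$, hence are themselves L-algebras. $X/I$ is the quotient by the congruence $x\equiv y\iff x\cdot y,\ y\cdot x\in I$. A Hilbert algebra $Y$ operates on a Hilbert algebra $X$ via $\rho:Y\to\mathrm{End}(X)$ (as Hilbert algebras) if for all $u,v\in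 Y$, $x,y\in X$: $\rho_1=\mathrm{id}$; $\rho_{u\cdot v}\circ\rho_u=\rho_{v\cdot u}\circ\rho_v$; $x\cdot\rho_u(x)=1$; $\rho_u\rho_v=\rho_v\rho_u$; $\rho_u(x\cdot y)=x\cdot\rho_u(y)$; and $\rho_u^2=\rho_u$. The symmetric semidirect product is then the Hilbert algebra $X\bowtie_\rho Y=\{(x,u)\in X\times Y\mid\rho_u(x)=x\}$ with operation $(x,u)\cdot(y,v)=(\rho_{u\cdot v}(x)\cdot\rho_{v\cdot u}(y),\,u\cdot v)$. *)

theory Defs
  imports "HOL-Algebra.Group"
begin

text \<open>
  L-algebras live on the \<open>monoid\<close> record of HOL-Algebra, used purely as the signature
  (carrier, binary operation, distinguished element): no monoid law is assumed, and
  \<open>x \<otimes> y\<close> is the L-algebra operation \<open>x \<cdot> y\<close>. Since the library's \<open>hom\<close> only asks for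
  compatibility with the operation, \<open>hom X X\<close> is \<open>End(X)\<close> and \<open>\<cong>\<close> is
  isomorphism of L-algebras (the distinguished element is preserved because it equals
  \<open>x \<cdot> x\<close>). Elements of \<open>hom\<close> are only constrained on the carrier, so equations between
  endomorphisms are stated pointwise on the carrier.
\<close>

locale l_algebra =
  fixes X :: "('a, 'm) monoid_scheme" (structure)
  assumes mult_closed: "\<lbrakk>x \<in> carrier X; y \<in> carrier X\<rbrakk> \<Longrightarrow> x \<otimes> y \<in> carrier X"
    and one_closed: "\<one> \<in> carrier X"
    and one_mult: "x \<in> carrier X \<Longrightarrow> \<one> \<otimes> x = x"
    and mult_one: "x \<in> carrier X \<Longrightarrow> x \<otimes> \<one> = \<one>"
    and mult_self: "x \<in> carrier X \<Longrightarrow> x \<otimes> x = \<one>"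
    and cycloid: "\<lbrakk>x \<in> carrier X; y \<in> carrier X; z \<in> carrier X\<rbrakk>
      \<Longrightarrow> (x \<otimes> y) \<otimes> (x \<otimes> z) = (y \<otimes> x) \<otimes> (y \<otimes> z)"
    and antisymmetry: "\<lbrakk>x \<in> carrier X; y \<in> carrier X; x \<otimes> y = \<one>; y \<otimes> x = \<one>\<rbrakk> \<Longrightarrow> x = y"

definition l_le :: "('a, 'm) monoid_scheme \<Rightarrow> 'a \<Rightarrow> 'a \<Rightarrow> bool" where
  "l_le X x y \<longleftrightarrow> x \<otimes>\<^bsub>X\<^esub> y = \<one>\<^bsub>X\<^esub>"

locale hilbert_algebra = l_algebra +
  assumes self_distrib: "\<lbrakk>x \<in> carrier X; y \<in> carrier X; z \<in> carrier X\<rbrakk>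
      \<Longrightarrow> x \<otimes> (y \<otimes> z) = (x \<otimes> y) \<otimes> (x \<otimes> z)"

locale linear_hilbert_algebra = hilbert_algebra +
  assumes linear: "\<lbrakk>x \<in> carrier X; y \<in> carrier X\<rbrakk> \<Longrightarrow> l_le X x y \<or> l_le X y x"

locale l_ideal =
  fixes I :: "'a set" and X :: "('a, 'm) monoid_scheme" (structure)
  assumes subset: "I \<subseteq> carrier X"
    and nonempty: "I \<noteq> {}"
    and I1: "\<lbrakk>x \<in> I; y \<in> carrier X; x \<otimes> y \<in> I\<rbrakk> \<Longrightarrow> y \<in> I"
    and I2: "\<lbrakk>x \<in> I; y \<in> carrier X\<rbrakk> \<Longrightarrow> y \<otimes> x \<in> I"
    and I3: "\<lbrakk>x \<in> I; y \<in> carrier X\<rbrakk> \<Longrightarrow> (x \<otimes> y) \<otimes> y \<in> I"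
    and I4: "\<lbrakk>x \<in> I; y \<in> carrier X\<rbrakk> \<Longrightarrow> y \<otimes> (x \<otimes> y) \<in> I"

definition l_subalgebra :: "'a monoid \<Rightarrow> 'a set \<Rightarrow> 'a monoid" where
  "l_subalgebra X I = X\<lparr>carrier := I\<rparr>"

definition l_cong :: "('a, 'm) monoid_scheme \<Rightarrow> 'a set \<Rightarrow> ('a \<times> 'a) set" where
  "l_cong X I = {(x, y). x \<in> carrier X \<and> y \<in> carrier X \<and> x \<otimes>\<^bsub>X\<^esub> y \<in> I \<and> y \<otimes>\<^bsub>X\<^esub> x \<in> I}"

text \<open>
  For a congruence, the union over all representatives below is the single class
  of \<open>a \<cdot> b\<close>, for any \<open>a \<in> A\<close> and \<open>b \<in> B\<close>.
\<close>

definition l_quotient :: "('a, 'm) monoid_scheme \<Rightarrow> 'a set \<Rightarrow> 'a set monoid" where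
  "l_quotient X I =
    \<lparr>carrier = carrier X // l_cong X I,
     monoid.mult = (\<lambda>A B. \<Union>a\<in>A. \<Union>b\<in>B. l_cong X I `` {a \<otimes>\<^bsub>X\<^esub> b}),
     one = l_cong X I `` {\<one>\<^bsub>X\<^esub>}\<rparr>"

locale hilbert_operation =
  Y: hilbert_algebra Y + X: hilbert_algebra X
  for Y :: "('b, 'n) monoid_scheme" and X :: "('a, 'm) monoid_scheme"
    and \<rho> :: "'b \<Rightarrow> 'a \<Rightarrow> 'a" +
  assumes endo: "u \<in> carrier Y \<Longrightarrow> \<rho> u \<in> hom X X"
    and op_one: "x \<in> carrier X \<Longrightarrow> \<rho> \<one>\<^bsub>Y\<^esub> x = x"
    and op_cycloid: "\<lbrakk>u \<in> carrier Y; v \<in> carrier Y; x \<in> carrier X\<rbrakk>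
      \<Longrightarrow> \<rho> (u \<otimes>\<^bsub>Y\<^esub> v) (\<rho> u x) = \<rho> (v \<otimes>\<^bsub>Y\<^esub> u) (\<rho> v x)"
    and op_increasing: "\<lbrakk>u \<in> carrier Y; x \<in> carrier X\<rbrakk> \<Longrightarrow> x \<otimes>\<^bsub>X\<^esub> \<rho> u x = \<one>\<^bsub>X\<^esub>"
    and op_commute: "\<lbrakk>u \<in> carrier Y; v \<in> carrier Y; x \<in> carrier X\<rbrakk>
      \<Longrightarrow> \<rho> u (\<rho> v x) = \<rho> v (\<rho> u x)"
    and op_mult: "\<lbrakk>u \<in> carrier Y; x \<in> carrier X; y \<in> carrier X\<rbrakk>
      \<Longrightarrow> \<rho> u (x \<otimes>\<^bsub>X\<^esub> y) = x \<otimes>\<^bsub>X\<^esub> \<rho> u y"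
    and op_idem: "\<lbrakk>u \<in> carrier Y; x \<in> carrier X\<rbrakk> \<Longrightarrow> \<rho> u (\<rho> u x) = \<rho> u x"

definition symm_semidirect ::
  "('a, 'm) monoid_scheme \<Rightarrow> ('b \<Rightarrow> 'a \<Rightarrow> 'a) \<Rightarrow> ('b, 'n) monoid_scheme \<Rightarrow> ('a \<times> 'b) monoid" where
  "symm_semidirect X \<rho> Y =
    \<lparr>carrier = {(x, u). x \<in> carrier X \<and> u \<in> carrier Y \<and> \<rho> u x = x},
     monoid.mult = (\<lambda>(x, u) (y, v).
       (\<rho> (u \<otimes>\<^bsub>Y\<^esub> v) x \<otimes>\<^bsub>X\<^esub> \<rho> (v \<otimes>\<^bsub>Y\<^esub> u) y, u \<otimes>\<^bsub>Y\<^esub> v)),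
     one = (\<one>\<^bsub>X\<^esub>, \<one>\<^bsub>Y\<^esub>)\<rparr>"

end

theory Submission
  imports Defs
begin

text \<open>
  In a linear Hilbert algebra \<open>x \<cdot> y\<close> is \<open>1\<close> if \<open>x \<le> y\<close> and \<open>y\<close> otherwise, and an ideal \<open>I\<close> is
  a nonempty up-set; hence \<open>X/I\<close> collapses \<open>I\<close> to a point and leaves the other elements alone.
  For (1) let the class \<open>I\<close> act on \<open>I\<close> as the identity and every other class as the constant \<open>1\<close>;
  then \<open>x \<mapsto> (x, I)\<close> on \<open>I\<close> and \<open>x \<mapsto> (1, [x])\<close> elsewhere is an isomorphism.
  For (2), the isomorphism followed by the projection to \<open>Y\<close> is a surjective homomorphism
  \<open>X \<rightarrow> Y\<close> whose kernel \<open>J\<close> is an up-set of size \<open>|I|\<close>. In a finite chain an up-set is determined by its size, so \<open>J = I\<close> and \<open>Y \<cong> X/I\<close>.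
\<close>

section \<open>Hilbert algebras and their quotients\<close>

context hilbert_algebra
begin

text \<open>Self-distributivity turns the two sides into the two sides of the cycloid
  identity.\<close>

lemma exchange:
  assumes "x \<in> carrier X" "y \<in> carrier X" "z \<in> carrier X"
  shows "x \<otimes> (y \<otimes> z) = y \<otimes> (x \<otimes> z)"
  using assms cycloid self_distrib by metis

lemma weaken:
  assumes "x \<in> carrier X" "y \<in> carrier X"
  shows "y \<otimes> (x \<otimes> y) = \<one>"
  using assms exchange mult_self mult_one by metis

text \<open>Antitonicity of \<open>\<otimes>\<close> in its left argument, internalised as one
  element equal to \<open>\<one>\<close>: once \<open>x \<otimes> a\<close> lies in an ideal, so
  does the factor to its right.\<close>

lemma mult_antimono:
  assumes "x \<in> carrier X" "a \<in> carrier X" "y \<in> carrier X"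
  shows "(x \<otimes> a) \<otimes> ((a \<otimes> y) \<otimes> (x \<otimes> y)) = \<one>"
proof -
  have "(x \<otimes> a) \<otimes> ((a \<otimes> y) \<otimes> (x \<otimes> y)) = (a \<otimes> y) \<otimes> ((x \<otimes> a) \<otimes> (x \<otimes> y))"
    using assms by (intro exchange) (auto intro: mult_closed)
  also have "\<dots> = (a \<otimes> y) \<otimes> (x \<otimes> (a \<otimes> y))"
    using assms self_distrib by simp
  also have "\<dots> = \<one>"
    using assms by (auto intro: weaken mult_closed)
  finally show ?thesis .
qed

end

locale hilbert_ideal = hilbert_algebra X + l_ideal I X
  for X :: "'a monoid" (structure) and I :: "'a set"
begin

definition cls :: "'a \<Rightarrow> 'a set" where
  "cls x = l_cong X I `` {x}"

lemma mem_cls_iff: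
  "y \<in> cls x \<longleftrightarrow> x \<in> carrier X \<and> y \<in> carrier X \<and> x \<otimes> y \<in> I \<and> y \<otimes> x \<in> I"
  by (simp add: cls_def l_cong_def)

lemma ideal_carrier: "x \<in> I \<Longrightarrow> x \<in> carrier X"
  using subset by blast

lemma one_ideal: "\<one> \<in> I"
proof -
  obtain x where "x \<in> I" using nonempty by blast
  then have "x \<otimes> x \<in> I" by (auto intro: I2 ideal_carrier)
  with \<open>x \<in> I\<close> show ?thesis by (simp add: mult_self ideal_carrier)
qed

lemma ideal_up: "x \<in> I \<Longrightarrow> y \<in> carrier X \<Longrightarrow> x \<otimes> y = \<one> \<Longrightarrow> y \<in> I"
  using I1 one_ideal by metis

text \<open>I2 puts \<open>x \<otimes> (y \<otimes> z)\<close>, which equals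
  \<open>(x \<otimes> y) \<otimes> (x \<otimes> z)\<close>, into \<open>I\<close>; I1 then cancels
  \<open>x \<otimes> y\<close>.\<close>

lemma ideal_trans:
  assumes "x \<in> carrier X" "y \<in> carrier X" "z \<in> carrier X" "x \<otimes> y \<in> I" "y \<otimes> z \<in> I"
  shows "x \<otimes> z \<in> I"
proof -
  have "(x \<otimes> y) \<otimes> (x \<otimes> z) \<in> I"
    using assms I2 self_distrib by metis
  with assms show ?thesis by (auto intro: I1 mult_closed)
qed

lemma equiv_cong: "equiv (carrier X) (l_cong X I)"
  by (rule equivI) (auto simp: l_cong_def refl_on_def sym_def trans_def mult_self one_ideal
      intro: ideal_trans)

lemma cls_eq_iff:
  assumes "x \<in> carrier X" "y \<in> carrier X"
  shows "cls x = cls y \<longleftrightarrow> x \<otimes> y \<in> I \<and> y \<otimes> x \<in> I"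
  using eq_equiv_class_iff[OF equiv_cong assms] assms by (auto simp: cls_def l_cong_def)

lemma cls_eq_one_iff:
  assumes "x \<in> carrier X"
  shows "cls x = cls \<one> \<longleftrightarrow> x \<in> I"
  using assms by (auto simp: cls_eq_iff one_closed one_mult mult_one one_ideal)

text \<open>The arguments change one at a time, through \<open>x \<otimes> y\<close>: antitonicity
  handles the left one, and \<open>(x \<otimes> y) \<otimes> (x \<otimes> b) = x \<otimes> (y
  \<otimes> b)\<close> the right one. Compatibility of the congruence with \<open>\<otimes>\<close>
  takes one use in each direction.\<close>

lemma mult_cong_ideal:
  assumes "x \<in> carrier X" "a \<in> carrier X" "y \<in> carrier X" "b \<in> carrier X"
    and "x \<otimes> a \<in> I" "y \<otimes> b \<in> I"
  shows "(a \<otimes> y) \<otimes> (x \<otimes> b) \<in> I"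
proof (rule ideal_trans)
  show "(a \<otimes> y) \<otimes> (x \<otimes> y) \<in> I"
    using assms mult_antimono by (auto intro!: ideal_up[of "x \<otimes> a"] mult_closed)
  show "(x \<otimes> y) \<otimes> (x \<otimes> b) \<in> I"
    using assms I2 self_distrib by metis
qed (use assms in \<open>auto intro: mult_closed\<close>)

lemma quotient_mult:
  assumes "x \<in> carrier X" "y \<in> carrier X"
  shows "cls x \<otimes>\<^bsub>l_quotient X I\<^esub> cls y = cls (x \<otimes> y)"
proof -
  have "cls (a \<otimes> b) = cls (x \<otimes> y)" if "a \<in> cls x" "b \<in> cls y" for a b
    using that assms by (auto simp: mem_cls_iff cls_eq_iff mult_closed intro: mult_cong_ideal)
  moreover have "x \<in> cls x" "y \<in> cls y"
    using assms by (auto simp: mem_cls_iff mult_self one_ideal)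
  ultimately have "(\<Union>a\<in>cls x. \<Union>b\<in>cls y. cls (a \<otimes> b)) = cls (x \<otimes> y)"
    by blast
  then show ?thesis
    by (simp add: l_quotient_def flip: cls_def)
qed

lemma quotient_carrier: "carrier (l_quotient X I) = cls ` carrier X"
  by (auto simp: l_quotient_def quotient_def cls_def)

lemma quotient_one: "\<one>\<^bsub>l_quotient X I\<^esub> = cls \<one>"
  by (simp add: l_quotient_def cls_def)

lemma hilbert_quotient: "hilbert_algebra (l_quotient X I)"
proof (unfold_locales, goal_cases)
  \<comment> \<open>Goal 7 is antisymmetry: a product of classes is the unit exactly when the
    product of representatives lies in \<open>I\<close>, so two such products give the congruence
    itself. Goals 6 and 8, the cycloid identity and self-distributivity, are inherited from
    representatives.\<close>
  case (7 A B)
  then obtain x y where "x \<in> carrier X" "y \<in> carrier X" "A = cls x" "B = cls y"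
    by (auto simp: quotient_carrier)
  with 7 show ?case
    by (simp add: quotient_one quotient_mult cls_eq_one_iff mult_closed cls_eq_iff)
next
  case (6 A B C)
  then obtain x y z where "x \<in> carrier X" "y \<in> carrier X" "z \<in> carrier X"
    "A = cls x" "B = cls y" "C = cls z"
    by (auto simp: quotient_carrier)
  then show ?case
    by (simp add: quotient_mult mult_closed cycloid[of x y z])
next
  case (8 A B C)
  then obtain x y z where "x \<in> carrier X" "y \<in> carrier X" "z \<in> carrier X"
    "A = cls x" "B = cls y" "C = cls z"
    by (auto simp: quotient_carrier)
  then show ?case
    by (simp add: quotient_mult mult_closed self_distrib[of x y z])
qed (auto simp: quotient_carrier quotient_one quotient_mult mult_closed one_closed one_mult
    mult_one mult_self)

lemma hilbert_subalgebra: "hilbert_algebra (l_subalgebra X I)"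
proof (unfold_locales, goal_cases)
  case (6 x y z)
  then show ?case
    using cycloid[of x y z] by (simp add: l_subalgebra_def ideal_carrier)
next
  case (8 x y z)
  then show ?case
    using self_distrib[of x y z] by (simp add: l_subalgebra_def ideal_carrier)
qed (simp_all add: l_subalgebra_def ideal_carrier one_ideal one_mult mult_one mult_self I2
    antisymmetry)

lemma first_isomorphism:
  assumes hom: "s \<in> hom X Y" and surj: "s ` carrier X = carrier Y" and Y: "l_algebra Y"
    and kernel: "\<And>x. x \<in> carrier X \<Longrightarrow> s x = \<one>\<^bsub>Y\<^esub> \<longleftrightarrow> x \<in> I"
  shows "Y \<cong> l_quotient X I"
proof -
  interpret Y: l_algebra Y by fact
  have s_closed: "s x \<in> carrier Y" if "x \<in> carrier X" for x
    using that surj by blast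
  have s_mult: "s (x \<otimes> y) = s x \<otimes>\<^bsub>Y\<^esub> s y" if "x \<in> carrier X" "y \<in> carrier X" for x y
    using that hom by (simp add: hom_mult)
  \<comment> \<open>By antisymmetry in \<open>Y\<close>, the images agree iff both products of them
    are the unit, so the kernel determines all fibres.\<close>
  have s_eq: "s x = s y \<longleftrightarrow> x \<otimes> y \<in> I \<and> y \<otimes> x \<in> I"
    if "x \<in> carrier X" "y \<in> carrier X" for x y
    using that kernel[of "x \<otimes> y"] kernel[of "y \<otimes> x"] s_mult s_closed mult_closed
      Y.mult_self Y.antisymmetry by metis
  \<comment> \<open>The inverse of the induced map from X/I to \<open>Y\<close>: the fibres of
    \<open>s\<close> are exactly the congruence classes.\<close>
  define g where "g u = {x \<in> carrier X. s x = u}" for u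
  have g: "g (s x) = cls x" if "x \<in> carrier X" for x
    using that s_eq by (auto simp: g_def mem_cls_iff)
  have "g \<in> hom Y (l_quotient X I)"
  proof (rule homI)
    fix u assume "u \<in> carrier Y"
    then show "g u \<in> carrier (l_quotient X I)"
      unfolding surj[symmetric] using g by (auto simp: quotient_carrier)
  next
    fix u v assume "u \<in> carrier Y" "v \<in> carrier Y"
    then obtain x y where "x \<in> carrier X" "y \<in> carrier X" "u = s x" "v = s y"
      unfolding surj[symmetric] by auto
    then show "g (u \<otimes>\<^bsub>Y\<^esub> v) = g u \<otimes>\<^bsub>l_quotient X I\<^esub> g v"
      by (simp add: g quotient_mult mult_closed flip: s_mult)
  qed
  moreover have "inj_on g (carrier Y)"
    unfolding surj[symmetric] by (auto simp: inj_on_def g cls_eq_iff s_eq)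
  moreover have "g ` carrier Y = carrier (l_quotient X I)"
    unfolding surj[symmetric] quotient_carrier image_image using g by simp
  ultimately show ?thesis
    by (auto simp: is_iso_def iso_def bij_betw_def)
qed

end

section \<open>Semidirect products\<close>

text \<open>With X/I acting on \<open>I\<close> this is the operation of (1). In
  \<open>op_cycloid\<close>, if one of \<open>u\<close>, \<open>v\<close> is the unit, both sides
  are the action of the other on \<open>x\<close>; if neither is, both sides are
  \<open>\<one>\<close>, which every map fixes.\<close>

lemma trivial_operation:
  assumes "hilbert_algebra Y" "hilbert_algebra X"
  shows "hilbert_operation Y X (\<lambda>u x. if u = \<one>\<^bsub>Y\<^esub> then x else \<one>\<^bsub>X\<^esub>)"
proof -
  interpret Y: hilbert_algebra Y by fact
  interpret X: hilbert_algebra X by fact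
  show ?thesis
    by unfold_locales (auto simp: hom_def X.one_closed X.mult_closed X.mult_one X.mult_self
        Y.one_mult Y.mult_one)
qed

context hilbert_operation
begin

lemma op_closed: "u \<in> carrier Y \<Longrightarrow> x \<in> carrier X \<Longrightarrow> \<rho> u x \<in> carrier X"
  using endo by (auto simp: hom_def)

lemma op_fixes_one: "u \<in> carrier Y \<Longrightarrow> \<rho> u \<one>\<^bsub>X\<^esub> = \<one>\<^bsub>X\<^esub>"
  using op_increasing X.one_mult op_closed X.one_closed by metis

lemma snd_hom: "snd \<in> hom (symm_semidirect X \<rho> Y) Y"
  by (auto simp: hom_def symm_semidirect_def)

lemma snd_surj: "snd ` carrier (symm_semidirect X \<rho> Y) = carrier Y"
proof -
  have "(\<one>\<^bsub>X\<^esub>, u) \<in> carrier (symm_semidirect X \<rho> Y)" if "u \<in> carrier Y" for u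
    using that by (simp add: symm_semidirect_def X.one_closed op_fixes_one)
  then show ?thesis
    by (force simp: symm_semidirect_def)
qed

text \<open>Over the unit of \<open>Y\<close> the fixed-point condition is void because the unit
  acts as the identity. The kernel of the projection is thus a copy of all of \<open>X\<close>,
  which gives its size.\<close>

lemma snd_kernel:
  "{p \<in> carrier (symm_semidirect X \<rho> Y). snd p = \<one>\<^bsub>Y\<^esub>} = carrier X \<times> {\<one>\<^bsub>Y\<^esub>}"
  by (auto simp: symm_semidirect_def op_one Y.one_closed)

end

section \<open>Ideals of linear Hilbert algebras\<close>

text \<open>For \<open>w = x \<otimes> y\<close> one has \<open>x \<otimes> w = w\<close>, so
  \<open>w \<noteq> \<one>\<close> excludes x \<le> w and linearity gives w \<le> x. The cycloid
  identity then yields w \<le> y, while y \<le> w always holds.\<close>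

lemma (in linear_hilbert_algebra) mult_eq:
  assumes x: "x \<in> carrier X" and y: "y \<in> carrier X" and nle: "x \<otimes> y \<noteq> \<one>"
  shows "x \<otimes> y = y"
proof -
  let ?w = "x \<otimes> y"
  have w: "?w \<in> carrier X" using x y by (rule mult_closed)
  have "x \<otimes> ?w = ?w"
    using x y w self_distrib mult_self one_mult by metis
  with nle have "?w \<otimes> x = \<one>"
    using linear[OF w x] by (auto simp: l_le_def)
  then have "?w \<otimes> y = (?w \<otimes> x) \<otimes> (?w \<otimes> y)"
    using w y by (simp add: one_mult mult_closed)
  also have "\<dots> = (x \<otimes> ?w) \<otimes> (x \<otimes> y)"
    using w x y by (intro cycloid)
  also have "\<dots> = \<one>"
    using \<open>x \<otimes> ?w = ?w\<close> w by (simp add: mult_self)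
  finally show ?thesis
    using antisymmetry[OF w y] weaken[OF x y] by simp
qed

locale linear_hilbert_ideal = linear_hilbert_algebra X + hilbert_ideal X I
  for X :: "'a monoid" (structure) and I :: "'a set"
begin

lemma nonideal_le:
  assumes "x \<in> I" "y \<in> carrier X" "y \<notin> I"
  shows "y \<otimes> x = \<one>"
  using assms linear[of x y] ideal_up[of x y] ideal_carrier[of x] by (auto simp: l_le_def)

lemma ideal_mult_nonideal:
  assumes "x \<in> I" "y \<in> carrier X" "y \<notin> I"
  shows "x \<otimes> y = y"
  using assms mult_eq[of x y] ideal_up[of x y] ideal_carrier[of x] by auto

text \<open>An element \<open>y\<close> congruent to \<open>x\<close> is outside \<open>I\<close> by
  I1. A product that lies in \<open>I\<close> while its right factor does not must be
  \<open>\<one>\<close>, so x \<le> y and y \<le> x.\<close>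

lemma cls_nonideal:
  assumes "x \<in> carrier X" "x \<notin> I"
  shows "cls x = {x}"
proof -
  have "y = x" if "y \<in> carrier X" "x \<otimes> y \<in> I" "y \<otimes> x \<in> I" for y
  proof (rule antisymmetry)
    show "y \<otimes> x = \<one>"
      using that assms mult_eq[of y x] by metis
    show "x \<otimes> y = \<one>"
      using that assms mult_eq[of x y] I1[of y x] by metis
  qed (use that assms in auto)
  then show ?thesis
    using assms by (auto simp: mem_cls_iff mult_self one_ideal)
qed

lemma iso_semidirect:
  defines "Q \<equiv> l_quotient X I" and "S \<equiv> l_subalgebra X I"
  shows "X \<cong> symm_semidirect S (\<lambda>u x. if u = \<one>\<^bsub>Q\<^esub> then x else \<one>\<^bsub>S\<^esub>) Q"
    (is "X \<cong> ?P")
proof -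
  interpret Q: hilbert_algebra Q unfolding Q_def by (rule hilbert_quotient)
  have S: "carrier S = I" "\<one>\<^bsub>S\<^esub> = \<one>" "x \<otimes>\<^bsub>S\<^esub> y = x \<otimes> y" for x y
    by (simp_all add: S_def l_subalgebra_def)
  have Q: "cls x \<in> carrier Q" if "x \<in> carrier X" for x
    using that by (simp add: Q_def quotient_carrier)
  have Q_mult: "cls x \<otimes>\<^bsub>Q\<^esub> cls y = cls (x \<otimes> y)" if "x \<in> carrier X" "y \<in> carrier X" for x y
    using that by (simp add: Q_def quotient_mult)
  have Q_one: "cls x = \<one>\<^bsub>Q\<^esub> \<longleftrightarrow> x \<in> I" if "x \<in> carrier X" for x
    using that by (simp add: Q_def quotient_one cls_eq_one_iff)
  \<comment> \<open>The second component is the unit of \<open>Q\<close> exactly on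
    \<open>I\<close>; off \<open>I\<close> the first one is set to \<open>\<one>\<close>, the only
    point fixed by a non-unit class.\<close>
  define f where "f x = (if x \<in> I then x else \<one>, cls x)" for x
  have "f \<in> hom X ?P"
  proof (rule homI)
    fix x assume "x \<in> carrier X"
    then show "f x \<in> carrier ?P"
      by (auto simp: symm_semidirect_def f_def S one_ideal Q Q_one)
  next
    fix x y assume xy: "x \<in> carrier X" "y \<in> carrier X"
    \<comment> \<open>Here the product is \<open>\<one>\<close> or \<open>y\<close>, so the first
      component of its image is \<open>\<one>\<close> whichever branch of \<open>f\<close>
      applies.\<close>
    have "x \<otimes> y \<in> I \<longleftrightarrow> x \<otimes> y = \<one>" if "y \<notin> I"
      using that xy mult_eq one_ideal by metis
    then show "f (x \<otimes> y) = f x \<otimes>\<^bsub>?P\<^esub> f y"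
      using xy
      by (auto simp: symm_semidirect_def f_def S Q_mult Q_one mult_closed one_closed mult_self
          one_mult mult_one I2 one_ideal nonideal_le ideal_mult_nonideal)
  qed
  moreover have "inj_on f (carrier X)"
  proof (rule inj_onI)
    fix x y assume xy: "x \<in> carrier X" "y \<in> carrier X" and eq: "f x = f y"
    have "x \<in> I \<longleftrightarrow> y \<in> I"
      using eq xy Q_one by (metis f_def prod.inject)
    then show "x = y"
      using xy eq by (auto simp: f_def cls_nonideal split: if_splits)
  qed
  moreover have "carrier ?P \<subseteq> f ` carrier X"
  proof
    fix p assume p: "p \<in> carrier ?P"
    then obtain a U where pU: "p = (a, U)" "a \<in> I" "U \<in> carrier Q"
      and U: "U = \<one>\<^bsub>Q\<^esub> \<or> a = \<one>"
      by (auto simp: symm_semidirect_def S split: if_splits)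
    then obtain x where "x \<in> carrier X" "U = cls x"
      by (auto simp: Q_def quotient_carrier)
    with pU U have px: "p = (a, cls x)" "a \<in> I" "x \<in> carrier X"
      and fixed: "x \<in> I \<or> a = \<one>"
      by (simp_all add: Q_one)
    \<comment> \<open>For the unit class the first component is the preimage; any other class is a
      singleton, and its element is the preimage.\<close>
    have "f (if x \<in> I then a else x) = p"
      using px fixed Q_one[of a] Q_one[of x] ideal_carrier[of a] by (auto simp: f_def)
    then show "p \<in> f ` carrier X"
      using px ideal_carrier[of a] by (metis image_eqI)
  qed
  moreover have "f ` carrier X \<subseteq> carrier ?P"
    using \<open>f \<in> hom X ?P\<close> by (auto dest: hom_carrier)
  ultimately show ?thesis
    by (auto simp: is_iso_def iso_def bij_betw_def)
qed

text \<open>Up-sets of a chain are nested: given an element of each outside the other, the larger of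
  the two would lie in both. Nested finite sets of equal size coincide.\<close>

lemma ideal_eqI:
  assumes "finite (carrier X)"
    and J: "J \<subseteq> carrier X" "card J = card I"
    and up: "\<And>x y. x \<in> J \<Longrightarrow> y \<in> carrier X \<Longrightarrow> x \<otimes> y = \<one> \<Longrightarrow> y \<in> J"
  shows "J = I"
proof -
  have "finite I" "finite J"
    using assms subset finite_subset by blast+
  moreover have "I \<subseteq> J \<or> J \<subseteq> I"
  proof (rule ccontr)
    assume "\<not> (I \<subseteq> J \<or> J \<subseteq> I)"
    then obtain x y where "x \<in> I" "x \<notin> J" "y \<in> J" "y \<notin> I" by blast
    moreover from this have "x \<in> carrier X" "y \<in> carrier X"
      using subset J by auto
    ultimately show False
      using linear[of x y] up[of y x] ideal_up[of x y] by (auto simp: l_le_def)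
  qed
  ultimately show ?thesis
    using J card_subset_eq by metis
qed

lemma semidirect_quotient:
  assumes fin: "finite (carrier X)"
    and op: "hilbert_operation Y (l_subalgebra X I) \<rho>"
    and iso: "X \<cong> symm_semidirect (l_subalgebra X I) \<rho> Y"
  shows "Y \<cong> l_quotient X I"
proof -
  let ?P = "symm_semidirect (l_subalgebra X I) \<rho> Y"
  interpret op: hilbert_operation Y "l_subalgebra X I" \<rho> by fact
  obtain f where hom: "f \<in> hom X ?P" and bij: "bij_betw f (carrier X) (carrier ?P)"
    using iso by (auto simp: is_iso_def iso_def)
  define s where "s = snd \<circ> f"
  have s_hom: "s \<in> hom X Y"
    unfolding s_def using hom op.snd_hom by (rule hom_compose)
  have s_surj: "s ` carrier X = carrier Y"
    using bij op.snd_surj by (simp add: s_def bij_betw_def flip: image_image image_comp)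
  \<comment> \<open>Members of \<open>hom\<close> respect only the operation, so the unit is
    recovered as the product of an element with itself.\<close>
  have s_one: "s \<one> = \<one>\<^bsub>Y\<^esub>"
    using hom_mult[OF s_hom one_closed one_closed] mult_self[OF one_closed]
      op.Y.mult_self s_surj one_closed by (metis image_eqI)
  define J where "J = {x \<in> carrier X. s x = \<one>\<^bsub>Y\<^esub>}"
  have "f ` J = {p \<in> carrier ?P. snd p = \<one>\<^bsub>Y\<^esub>}"
    unfolding bij_betw_imp_surj_on[OF bij, symmetric] by (auto simp: J_def s_def)
  \<comment> \<open>The bijection \<open>f\<close> matches \<open>J\<close> with the kernel of the
    projection, a copy of \<open>I\<close>; hence the two have the same size.\<close>
  then have "f ` J = I \<times> {\<one>\<^bsub>Y\<^esub>}"
    by (simp add: op.snd_kernel) (simp add: l_subalgebra_def)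
  moreover have "inj_on f J"
    using bij_betw_imp_inj_on[OF bij] by (rule inj_on_subset) (auto simp: J_def)
  ultimately have card: "card J = card I"
    using card_image[of f J] by (simp add: card_cartesian_product)
  have up: "y \<in> J" if "x \<in> J" "y \<in> carrier X" "x \<otimes> y = \<one>" for x y
  proof -
    have "s y = s x \<otimes>\<^bsub>Y\<^esub> s y"
      using that op.Y.one_mult[of "s y"] hom_in_carrier[OF s_hom, of y] by (simp add: J_def)
    also have "\<dots> = \<one>\<^bsub>Y\<^esub>"
      using that hom_mult[OF s_hom, of x y] s_one by (simp add: J_def)
    finally show ?thesis using that by (simp add: J_def)
  qed
  have "J = I"
    using fin _ card up by (rule ideal_eqI) (auto simp: J_def)
  then have "s x = \<one>\<^bsub>Y\<^esub> \<longleftrightarrow> x \<in> I" if "x \<in> carrier X" for x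
    using that by (auto simp: J_def)
  with s_hom s_surj op.Y.l_algebra_axioms show ?thesis
    by (rule first_isomorphism)
qed

end

theorem corollary5p6:
  fixes X :: "'a monoid" and I :: "'a set" and n :: nat
  assumes "linear_hilbert_algebra X"
    and "finite (carrier X)" and "card (carrier X) = n"
    and "l_ideal I X"
  shows "(\<exists>\<rho> :: 'a set \<Rightarrow> 'a \<Rightarrow> 'a.
            hilbert_operation (l_quotient X I) (l_subalgebra X I) \<rho> \<and>
            X \<cong> symm_semidirect (l_subalgebra X I) \<rho> (l_quotient X I))
       \<and> (\<forall>Y :: 'b monoid. hilbert_algebra Y \<longrightarrow>
            (\<exists>\<rho> :: 'b \<Rightarrow> 'a \<Rightarrow> 'a.
               hilbert_operation Y (l_subalgebra X I) \<rho> \<and>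
               X \<cong> symm_semidirect (l_subalgebra X I) \<rho> Y) \<longrightarrow>
            Y \<cong> l_quotient X I)"
proof -
  interpret X: linear_hilbert_algebra X by fact
  interpret linear_hilbert_ideal X I
    using assms by (simp add: linear_hilbert_ideal_def hilbert_ideal_def X.hilbert_algebra_axioms)
  show ?thesis
    using trivial_operation[OF hilbert_quotient hilbert_subalgebra] iso_semidirect
      semidirect_quotient[OF assms(2)] by blast
qed

end
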